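(* Let $\alpha\in(0,1)$ and $g\in\mathcal B_\alpha(\mathbb R)$. Then there exists a unique solution $u_\alpha\in\mathcal B_\alpha(\mathbb R^2_+)$ of the boundary value problem $$-\Delta u = 0 \ \text{ in } \mathbb R^2_+,\qquad u = g\ \text{ on }\partial\mathbb R^2_+,$$ where $\partial\mathbb R^2_+=\mathbb R\times\{0\}$ is identified with $\mathbb R$.
   Context: $\mathbb R^2_+=\{(x,y)\in\mathbb R^2: y>0\}$. For $\alpha>0$ let $\sigma_\alpha(z)=\max\{z,0\}^\alpha$ for $z\in\mathbb R$. For a Borel probability measure $\pi$ on $\mathbb R\times\mathbb R^d\times\mathbb R$ set $f_{\pi,\alpha}(x)=\mathbb E_{(a,w,b)\sim\pi}[a\,\sigma_\alpha(w^Tx+b)]$, $x\in\mathbb R^d$. For $D\subseteq\mathbb R^d$ and a continuous function $f:D\to\mathbb R$, $$\|f\|_{\mathcal B_\alpha(D)}=\inf\{\mathbb E_{(a,w,b)\sim\pi}[|a|(|w|+|b|)^\alpha] : f(x)=f_{\pi,\alpha}(x)\text{ for all }x\in D\},$$ and $\mathcal B_\alpha(D)=\{f\in C^0(D):\|f\|_{\mathcal B_\alpha(D)}<\infty\}$. Boundary values of a function on $\mathbb R^2_+$ are understood as those of its continuous extension to $\overline{\mathbb R^2_+}$. *)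

theory Defs
  imports "HOL-Probability.Probability" "HOL-Library.FuncSet"
begin

definition relu_pow :: "real \<Rightarrow> real \<Rightarrow> real" where
  "relu_pow \<alpha> z = max z 0 powr \<alpha>"

definition param_prob :: "(real \<times> 'a::euclidean_space \<times> real) measure \<Rightarrow> bool" where
  "param_prob \<pi> \<longleftrightarrow> prob_space \<pi> \<and> sets \<pi> = sets borel"

definition net_fun ::
    "real \<Rightarrow> (real \<times> 'a::euclidean_space \<times> real) measure \<Rightarrow> 'a \<Rightarrow> real" where
  "net_fun \<alpha> \<pi> x = (\<integral>(a, w, b). a * relu_pow \<alpha> (w \<bullet> x + b) \<partial>\<pi>)"

text \<open>
  The expectation defining \<^term>\<open>net_fun \<alpha> \<pi> x\<close> is required to exist, because the Bochner
  integral of a non-integrable function is 0 by convention.  For \<open>\<alpha> > 0\<close> the requirement holds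
  automatically if \<open>\<pi>\<close> has finite moment, so it does not affect the norm below.
\<close>

definition represents ::
    "real \<Rightarrow> (real \<times> 'a::euclidean_space \<times> real) measure \<Rightarrow> 'a set \<Rightarrow> ('a \<Rightarrow> real) \<Rightarrow> bool" where
  "represents \<alpha> \<pi> D f \<longleftrightarrow>
     (\<forall>x\<in>D. integrable \<pi> (\<lambda>(a, w, b). a * relu_pow \<alpha> (w \<bullet> x + b)) \<and> f x = net_fun \<alpha> \<pi> x)"

definition barron_norm :: "real \<Rightarrow> 'a::euclidean_space set \<Rightarrow> ('a \<Rightarrow> real) \<Rightarrow> ennreal" where
  "barron_norm \<alpha> D f =
     (INF \<pi> \<in> {\<pi>. param_prob \<pi> \<and> represents \<alpha> \<pi> D f}.
        \<integral>\<^sup>+(a, w, b). ennreal (\<bar>a\<bar> * (norm w + \<bar>b\<bar>) powr \<alpha>) \<partial>\<pi>)"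

text \<open>
  Functions \<open>D \<rightarrow> \<real>\<close> are encoded as total functions that are \<^term>\<open>undefined\<close> outside \<open>D\<close>, so
  that equality of elements of the space is equality on \<open>D\<close>.
\<close>

definition barron_space :: "real \<Rightarrow> 'a::euclidean_space set \<Rightarrow> ('a \<Rightarrow> real) set" where
  "barron_space \<alpha> D = {f \<in> extensional D. continuous_on D f \<and> barron_norm \<alpha> D f < \<infinity>}"

definition upper_half_plane :: "(real \<times> real) set" where
  "upper_half_plane = {(x, y). y > 0}"

definition partial_deriv :: "'a::euclidean_space \<Rightarrow> ('a \<Rightarrow> real) \<Rightarrow> 'a \<Rightarrow> real" where
  "partial_deriv i f x = frechet_derivative f (at x) i"

text \<open>The next two notions are meant for open sets \<open>S\<close>.\<close>

definition C1_on :: "'a::euclidean_space set \<Rightarrow> ('a \<Rightarrow> real) \<Rightarrow> bool" where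
  "C1_on S f \<longleftrightarrow> (\<forall>x\<in>S. f differentiable (at x)) \<and> (\<forall>i\<in>Basis. continuous_on S (partial_deriv i f))"

definition C2_on :: "'a::euclidean_space set \<Rightarrow> ('a \<Rightarrow> real) \<Rightarrow> bool" where
  "C2_on S f \<longleftrightarrow> C1_on S f \<and> (\<forall>i\<in>Basis. C1_on S (partial_deriv i f))"

definition laplacian :: "('a::euclidean_space \<Rightarrow> real) \<Rightarrow> 'a \<Rightarrow> real" where
  "laplacian f x = (\<Sum>i\<in>Basis. partial_deriv i (partial_deriv i f) x)"

text \<open>Boundary values are those of the continuous extension to the closed half plane.\<close>

definition has_boundary_values :: "(real \<times> real \<Rightarrow> real) \<Rightarrow> (real \<Rightarrow> real) \<Rightarrow> bool" where
  "has_boundary_values u g \<longleftrightarrow>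
     (\<exists>U. continuous_on (closure upper_half_plane) U \<and>
          (\<forall>z\<in>upper_half_plane. U z = u z) \<and>
          (\<forall>x. U (x, 0) = g x))"

definition solves_dirichlet :: "(real \<times> real \<Rightarrow> real) \<Rightarrow> (real \<Rightarrow> real) \<Rightarrow> bool" where
  "solves_dirichlet u g \<longleftrightarrow>
     C2_on upper_half_plane u \<and>
     (\<forall>z\<in>upper_half_plane. - laplacian u z = 0) \<and>
     has_boundary_values u g"

end

theory Submission
  imports Defs "HOL-Complex_Analysis.Complex_Analysis" "HOL-Real_Asymp.Real_Asymp"
begin

text \<open>
  Existence: substituting \<open>t = x - s y\<close> in the Poisson integral gives
  \<open>u (x, y) = \<integral> g (x - s y) ds / (\<pi> (1 + s\<^sup>2))\<close>.  For a ridge function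
  \<open>g x = a \<sigma> (w x + b)\<close> the integrand is again a ridge function, with weight \<open>(w, - s w)\<close>, so \<open>u\<close> is
  represented by the image of \<open>\<pi>\<close> times the Cauchy distribution; its moment is finite because
  \<open>(1 + \<bar>s\<bar>) powr \<alpha>\<close> is integrable against the Cauchy distribution exactly for \<open>\<alpha> < 1\<close>.
  Harmonicity holds since \<open>u\<close> is the imaginary part of a holomorphic Cauchy transform of \<open>g\<close>.
  Uniqueness: elements of the Barron space grow at most like \<open>(1 + norm z) powr \<alpha>\<close>, hence sublinearly,
  and a Phragmen-Lindeloef comparison on large rectangles applies.
\<close>

subsection \<open>Barron functions\<close>

text \<open>Each growth estimate below rests on a linear bound by a product, which this carries over
  to the power \<alpha>.\<close>

lemma powr_le_mult_powr:
  fixes p q r :: real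
  assumes "0 \<le> r" "r \<le> p * q" "0 \<le> p" "0 \<le> q" "0 \<le> \<alpha>"
  shows "r powr \<alpha> \<le> p powr \<alpha> * q powr \<alpha>"
  using assms by (metis powr_mono2 powr_mult)

lemma relu_pow_nonneg: "0 \<le> relu_pow \<alpha> z"
  by (simp add: relu_pow_def)

lemma continuous_on_relu_pow:
  assumes "0 < \<alpha>"
  shows "continuous_on A (relu_pow \<alpha>)"
  unfolding relu_pow_def using assms
  by (intro continuous_on_powr' continuous_intros) auto

text \<open>Cauchy-Schwarz separates the parameters from the point, so a single moment of the
  parameter measure controls the network at every \<open>x\<close>.\<close>

lemma relu_pow_inner_le:
  fixes w x :: "'a::euclidean_space"
  assumes "0 < \<alpha>"
  shows "relu_pow \<alpha> (w \<bullet> x + b) \<le> (norm w + \<bar>b\<bar>) powr \<alpha> * (1 + norm x) powr \<alpha>"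
  unfolding relu_pow_def
proof (rule powr_le_mult_powr)
  have "w \<bullet> x + b \<le> norm w * norm x + \<bar>b\<bar>"
    using norm_cauchy_schwarz[of w x] by linarith
  also have "\<dots> \<le> (norm w + \<bar>b\<bar>) * (1 + norm x)"
    by (simp add: algebra_simps)
  finally show "max (w \<bullet> x + b) 0 \<le> (norm w + \<bar>b\<bar>) * (1 + norm x)"
    by simp
qed (use assms in auto)

text \<open>Finiteness of the moment is phrased as Bochner integrability, so that domination and
  Fubini apply directly; \<open>has_moment_iff\<close> links it to the \<open>ennreal\<close>
  integral in \<open>barron_norm\<close>.\<close>

definition has_moment :: "real \<Rightarrow> (real \<times> 'a::euclidean_space \<times> real) measure \<Rightarrow> bool" where
  "has_moment \<alpha> \<pi> \<longleftrightarrow> integrable \<pi> (\<lambda>(a, w, b). \<bar>a\<bar> * (norm w + \<bar>b\<bar>) powr \<alpha>)"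

lemma measurable_param_prob:
  "param_prob \<pi> \<Longrightarrow> f \<in> borel_measurable borel \<Longrightarrow> f \<in> borel_measurable \<pi>"
  by (simp add: param_prob_def cong: measurable_cong_sets)

lemma measurable_net_integrand:
  assumes "0 < \<alpha>"
  shows "(\<lambda>(a, w, b). a * relu_pow \<alpha> (w \<bullet> x + b))
           \<in> borel_measurable (borel :: (real \<times> 'a::euclidean_space \<times> real) measure)"
  unfolding case_prod_beta
  by (intro borel_measurable_continuous_onI continuous_intros
      continuous_on_compose2[OF continuous_on_relu_pow[OF assms, of UNIV]]) auto

lemma measurable_moment_integrand:
  assumes "0 < \<alpha>"
  shows "(\<lambda>(a, w, b). \<bar>a\<bar> * (norm w + \<bar>b\<bar>) powr \<alpha>)
           \<in> borel_measurable (borel :: (real \<times> 'a::euclidean_space \<times> real) measure)"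
  unfolding case_prod_beta
  by (intro borel_measurable_continuous_onI continuous_intros continuous_on_powr') (use assms in auto)

lemma has_moment_iff:
  assumes "0 < \<alpha>" "param_prob \<pi>"
  shows "has_moment \<alpha> \<pi> \<longleftrightarrow> (\<integral>\<^sup>+(a, w, b). ennreal (\<bar>a\<bar> * (norm w + \<bar>b\<bar>) powr \<alpha>) \<partial>\<pi>) < \<infinity>"
  unfolding has_moment_def integrable_iff_bounded
  using measurable_param_prob[OF assms(2) measurable_moment_integrand[OF assms(1)]]
  by (simp add: case_prod_unfold)

lemma net_integrand_le:
  fixes x :: "'a::euclidean_space"
  assumes "0 < \<alpha>"
  shows "\<bar>case p of (a, w, b) \<Rightarrow> a * relu_pow \<alpha> (w \<bullet> x + b)\<bar>
           \<le> (case p of (a, w, b) \<Rightarrow> \<bar>a\<bar> * (norm w + \<bar>b\<bar>) powr \<alpha>) * (1 + norm x) powr \<alpha>"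
proof (cases p)
  case (fields a w b)
  have "\<bar>a\<bar> * relu_pow \<alpha> (w \<bullet> x + b) \<le> \<bar>a\<bar> * ((norm w + \<bar>b\<bar>) powr \<alpha> * (1 + norm x) powr \<alpha>)"
    by (intro mult_left_mono relu_pow_inner_le assms) simp
  with fields relu_pow_nonneg[of \<alpha> "w \<bullet> x + b"] show ?thesis
    by (simp add: abs_mult mult.assoc)
qed

lemma integrable_net_integrand:
  fixes x :: "'a::euclidean_space"
  assumes "0 < \<alpha>" "param_prob \<pi>" "has_moment \<alpha> \<pi>"
  shows "integrable \<pi> (\<lambda>(a, w, b). a * relu_pow \<alpha> (w \<bullet> x + b))"
proof (rule Bochner_Integration.integrable_bound)
  show "integrable \<pi> (\<lambda>p. (case p of (a, w, b) \<Rightarrow> \<bar>a\<bar> * (norm w + \<bar>b\<bar>) powr \<alpha>) * (1 + norm x) powr \<alpha>)"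
    using assms(3) unfolding has_moment_def by simp
  show "AE p in \<pi>. norm (case p of (a, w, b) \<Rightarrow> a * relu_pow \<alpha> (w \<bullet> x + b))
      \<le> norm ((case p of (a, w, b) \<Rightarrow> \<bar>a\<bar> * (norm w + \<bar>b\<bar>) powr \<alpha>) * (1 + norm x) powr \<alpha>)"
    unfolding real_norm_def by (intro AE_I2 order_trans[OF net_integrand_le[OF assms(1)] abs_ge_self])
qed (rule measurable_param_prob[OF assms(2) measurable_net_integrand[OF assms(1)]])

text \<open>The constant is the moment itself. This growth of order \<alpha> < 1 later yields both
  convergence of the Poisson integral and uniqueness.\<close>

lemma net_fun_growth:
  fixes \<pi> :: "(real \<times> 'a::euclidean_space \<times> real) measure"
  assumes "0 < \<alpha>" "param_prob \<pi>" "has_moment \<alpha> \<pi>"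
  obtains M where "\<And>x. \<bar>net_fun \<alpha> \<pi> x\<bar> \<le> M * (1 + norm x) powr \<alpha>"
proof
  fix x :: 'a
  have "\<bar>net_fun \<alpha> \<pi> x\<bar> \<le> (\<integral>p. (case p of (a, w, b) \<Rightarrow> \<bar>a\<bar> * (norm w + \<bar>b\<bar>) powr \<alpha>) * (1 + norm x) powr \<alpha> \<partial>\<pi>)"
    unfolding net_fun_def
    by (intro integral_abs_bound[THEN order_trans] integral_mono integrable_abs
        integrable_net_integrand assms net_integrand_le)
       (use assms(3) in \<open>simp add: has_moment_def\<close>)
  then show "\<bar>net_fun \<alpha> \<pi> x\<bar> \<le> (\<integral>p. (case p of (a, w, b) \<Rightarrow> \<bar>a\<bar> * (norm w + \<bar>b\<bar>) powr \<alpha>) \<partial>\<pi>) * (1 + norm x) powr \<alpha>"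
    by simp
qed

text \<open>An infimum below infinity has a member below infinity; it need not be attained, and any
  finite moment will do.\<close>

lemma barron_spaceE:
  fixes f :: "'a::euclidean_space \<Rightarrow> real"
  assumes "0 < \<alpha>" "f \<in> barron_space \<alpha> D"
  obtains \<pi> where "param_prob \<pi>" "has_moment \<alpha> \<pi>" "\<And>x. x \<in> D \<Longrightarrow> f x = net_fun \<alpha> \<pi> x"
proof -
  from assms(2) have "barron_norm \<alpha> D f < \<infinity>"
    by (simp add: barron_space_def)
  then obtain \<pi> where \<pi>: "param_prob \<pi>" "represents \<alpha> \<pi> D f"
    "(\<integral>\<^sup>+(a, w, b). ennreal (\<bar>a\<bar> * (norm w + \<bar>b\<bar>) powr \<alpha>) \<partial>\<pi>) < \<infinity>"
    unfolding barron_norm_def INF_less_iff by blast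
  show thesis
  proof (rule that)
    show "has_moment \<alpha> \<pi>"
      using has_moment_iff[OF assms(1) \<pi>(1)] \<pi>(3) by blast
    show "f x = net_fun \<alpha> \<pi> x" if "x \<in> D" for x
      using \<pi>(2) that by (simp add: represents_def)
  qed (rule \<pi>(1))
qed

text \<open>One measure with finite moment bounds the infimum, and the integrability demanded by
  \<open>represents\<close> follows from that moment.\<close>

lemma barron_spaceI:
  fixes f :: "'a::euclidean_space \<Rightarrow> real"
  assumes "0 < \<alpha>" "f \<in> extensional D" "continuous_on D f" "param_prob \<pi>" "has_moment \<alpha> \<pi>"
    "\<And>x. x \<in> D \<Longrightarrow> f x = net_fun \<alpha> \<pi> x"
  shows "f \<in> barron_space \<alpha> D"
proof -
  have "represents \<alpha> \<pi> D f"
    using assms by (simp add: represents_def integrable_net_integrand)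
  then have "barron_norm \<alpha> D f \<le> (\<integral>\<^sup>+(a, w, b). ennreal (\<bar>a\<bar> * (norm w + \<bar>b\<bar>) powr \<alpha>) \<partial>\<pi>)"
    unfolding barron_norm_def using assms(4) by (intro INF_lower) blast
  also have "\<dots> < \<infinity>"
    using has_moment_iff[OF assms(1,4)] assms(5) by blast
  finally have "barron_norm \<alpha> D f < \<infinity>" .
  with assms show ?thesis
    by (simp add: barron_space_def)
qed

lemma barron_space_growth:
  fixes f :: "'a::euclidean_space \<Rightarrow> real"
  assumes "0 < \<alpha>" "f \<in> barron_space \<alpha> D"
  obtains M where "\<And>x. x \<in> D \<Longrightarrow> \<bar>f x\<bar> \<le> M * (1 + norm x) powr \<alpha>"
proof -
  obtain \<pi> where \<pi>: "param_prob \<pi>" "has_moment \<alpha> \<pi>" "\<And>x. x \<in> D \<Longrightarrow> f x = net_fun \<alpha> \<pi> x"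
    using barron_spaceE[OF assms] by blast
  obtain M where "\<And>x. \<bar>net_fun \<alpha> \<pi> x\<bar> \<le> M * (1 + norm x) powr \<alpha>"
    using net_fun_growth[OF assms(1) \<pi>(1,2)] by blast
  with \<pi>(3) show thesis
    by (intro that[of M]) simp
qed

subsection \<open>The Cauchy distribution and the Poisson integral\<close>

text \<open>On the half line the antiderivative \<open>?F\<close> vanishes at infinity since
  \<open>r + 1 < 0\<close>; evenness then gives the whole line.\<close>

lemma integrable_one_plus_abs_powr:
  fixes r :: real
  assumes "r < - 1"
  shows "integrable lborel (\<lambda>s::real. (1 + \<bar>s\<bar>) powr r)"
proof -
  let ?F = "\<lambda>s. (1 + s) powr (r + 1) / (r + 1)"
  have lim: "(?F \<longlongrightarrow> 0) at_top"
    using assms by real_asymp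
  have eq: "ennreal (indicator {0..} s * (1 + \<bar>s\<bar>) powr r) = ennreal ((1 + \<bar>s\<bar>) powr r) * indicator {0..} s" for s :: real
    by (auto split: split_indicator)
  have "(\<integral>\<^sup>+s. ennreal ((1 + \<bar>s\<bar>) powr r) * indicator {0..} s \<partial>lborel) = ennreal (0 - ?F 0)"
    by (rule nn_integral_FTC_atLeast[OF _ _ _ lim])
      (use assms in \<open>auto intro!: derivative_eq_intros simp: add_pos_nonneg\<close>)
  then have "integrable lborel (\<lambda>s. indicator {0..} s *\<^sub>R (1 + \<bar>s\<bar>) powr r)"
    by (simp add: integrable_iff_bounded eq abs_mult)
  from has_bochner_integral_even_function[OF has_bochner_integral_integrable[OF this]]
  show ?thesis
    by (simp add: has_bochner_integral_iff)
qed

text \<open>The quotient decays like the power \<alpha> - 2 of \<open>1 + \<bar>s\<bar>\<close>, and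
  \<alpha> < 1 puts this exponent below -1.\<close>

lemma integrable_poisson_majorant:
  assumes "0 \<le> \<alpha>" "\<alpha> < 1"
  shows "integrable lborel (\<lambda>s::real. (1 + \<bar>s\<bar>) powr \<alpha> / (1 + s\<^sup>2))"
proof (rule Bochner_Integration.integrable_bound)
  show "integrable lborel (\<lambda>s::real. 2 * (1 + \<bar>s\<bar>) powr (\<alpha> - 2))"
    using assms by (intro integrable_mult_right integrable_one_plus_abs_powr) simp
  have "norm ((1 + \<bar>s\<bar>) powr \<alpha> / (1 + s\<^sup>2)) \<le> norm (2 * (1 + \<bar>s\<bar>) powr (\<alpha> - 2))" for s :: real
  proof -
    \<comment> \<open>This is nonnegativity of the square of
      \<open>1 - \<bar>s\<bar>\<close>.\<close>
    have "(1 + \<bar>s\<bar>)\<^sup>2 \<le> 2 * (1 + s\<^sup>2)"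
      using sum_squares_ge_zero[of "1 - \<bar>s\<bar>" 0] by (simp add: power2_eq_square algebra_simps)
    then have "(1 + \<bar>s\<bar>)\<^sup>2 * (1 + \<bar>s\<bar>) powr (\<alpha> - 2) \<le> 2 * (1 + s\<^sup>2) * (1 + \<bar>s\<bar>) powr (\<alpha> - 2)"
      by (intro mult_right_mono) auto
    moreover have "(1 + \<bar>s\<bar>)\<^sup>2 * (1 + \<bar>s\<bar>) powr (\<alpha> - 2) = (1 + \<bar>s\<bar>) powr \<alpha>"
      by (simp add: powr_diff add_pos_nonneg)
    moreover have "0 < 1 + s\<^sup>2"
      by (simp add: add_pos_nonneg)
    ultimately show ?thesis
      by (simp add: divide_le_eq algebra_simps)
  qed
  then show "AE s in lborel. norm ((1 + \<bar>s\<bar>) powr \<alpha> / (1 + s\<^sup>2)) \<le> norm (2 * (1 + \<bar>s\<bar>) powr (\<alpha> - 2))"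
    by simp
qed measurable

text \<open>The density is the Poisson kernel of the half plane at height 1; other heights arise by
  dilation.\<close>

definition cauchy_measure :: "real measure" where
  "cauchy_measure = density lborel (\<lambda>s. ennreal (1 / (pi * (1 + s\<^sup>2))))"

lemma sets_cauchy_measure [simp, measurable_cong]: "sets cauchy_measure = sets borel"
  by (simp add: cauchy_measure_def)

lemma space_cauchy_measure [simp]: "space cauchy_measure = UNIV"
  by (simp add: cauchy_measure_def)

lemma prob_space_cauchy_measure: "prob_space cauchy_measure"
proof
  have "integrable lborel (\<lambda>s::real. inverse (1 + s\<^sup>2))" "(\<integral>s. inverse (1 + s\<^sup>2) \<partial>lborel) = pi"
    using integrable_inverse_1_plus_square LBINT_inverse_1_plus_square
    by (auto simp: set_integrable_def interval_lebesgue_integral_def set_lebesgue_integral_def)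
  then have "integrable lborel (\<lambda>s::real. inverse (1 + s\<^sup>2) / pi)" "(\<integral>s. inverse (1 + s\<^sup>2) / pi \<partial>lborel) = 1"
    by simp_all
  then have "(\<integral>\<^sup>+s. ennreal (inverse (1 + s\<^sup>2) / pi) \<partial>lborel) = 1"
    by (subst nn_integral_eq_integral) auto
  moreover have "inverse (1 + s\<^sup>2) / pi = 1 / (pi * (1 + s\<^sup>2))" for s :: real
    by (simp add: field_simps)
  ultimately show "emeasure cauchy_measure (space cauchy_measure) = 1"
    by (simp add: cauchy_measure_def emeasure_density)
qed

lemma integrable_cauchy_iff:
  fixes f :: "real \<Rightarrow> real"
  assumes "f \<in> borel_measurable borel"
  shows "integrable cauchy_measure f \<longleftrightarrow> integrable lborel (\<lambda>s. f s / (1 + s\<^sup>2))"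
proof -
  have "integrable cauchy_measure f \<longleftrightarrow> integrable lborel (\<lambda>s. (1 / pi) * (f s / (1 + s\<^sup>2)))"
    unfolding cauchy_measure_def using assms
    by (subst integrable_real_density) (auto simp: add_nonneg_nonneg)
  also have "\<dots> \<longleftrightarrow> integrable lborel (\<lambda>s. f s / (1 + s\<^sup>2))"
    using integrable_mult_left_iff[of lborel "1 / pi" "\<lambda>s. f s / (1 + s\<^sup>2)"] by simp
  finally show ?thesis .
qed

lemma integral_cauchy:
  fixes f :: "real \<Rightarrow> real"
  assumes "f \<in> borel_measurable borel"
  shows "(\<integral>s. f s \<partial>cauchy_measure) = (\<integral>s. f s / (1 + s\<^sup>2) \<partial>lborel) / pi"
  unfolding cauchy_measure_def using assms
  by (subst integral_real_density) (auto simp: add_nonneg_nonneg mult.commute simp flip: integral_divide_zero)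

lemma integrable_cauchy_powr:
  assumes "0 \<le> \<alpha>" "\<alpha> < 1"
  shows "integrable cauchy_measure (\<lambda>s. (1 + \<bar>s\<bar>) powr \<alpha>)"
  using assms by (simp add: integrable_cauchy_iff integrable_poisson_majorant)

text \<open>Rescaling the variable by the height leaves a measure independent of the point, and the
  formula still makes sense at \<open>y = 0\<close>, where the usual kernel degenerates.\<close>

definition poisson_ext :: "(real \<Rightarrow> real) \<Rightarrow> real \<times> real \<Rightarrow> real" where
  "poisson_ext g = (\<lambda>(x, y). \<integral>s. g (x - s * y) \<partial>cauchy_measure)"

lemma poisson_ext_boundary: "poisson_ext g (x, 0) = g x"
  using prob_space.prob_space[OF prob_space_cauchy_measure]
  by (simp add: poisson_ext_def)

text \<open>The bound is uniform over a ball of points \<open>z\<close> and integrable in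
  \<open>s\<close>, as dominated convergence requires.\<close>

lemma abs_le_growth_shift:
  fixes g :: "real \<Rightarrow> real"
  assumes "0 < \<alpha>" "\<And>t. \<bar>g t\<bar> \<le> M * (1 + \<bar>t\<bar>) powr \<alpha>" "norm z \<le> B"
  shows "\<bar>g (fst z - s * snd z)\<bar> \<le> M * (1 + B) powr \<alpha> * (1 + \<bar>s\<bar>) powr \<alpha>"
proof -
  \<comment> \<open>At 0 the growth bound reads \<open>\<bar>g 0\<bar> \<le> M\<close>.\<close>
  have M: "0 \<le> M"
    using assms(2)[of 0] by simp
  have 1: "\<bar>fst z\<bar> \<le> B" "\<bar>snd z\<bar> \<le> B" "0 \<le> B"
    using assms(3) norm_fst_le[of "fst z" "snd z"] norm_snd_le[of "snd z" "fst z"] norm_ge_zero[of z]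
    by (auto simp del: norm_ge_zero)
  have "\<bar>fst z - s * snd z\<bar> \<le> \<bar>fst z\<bar> + \<bar>s\<bar> * \<bar>snd z\<bar>"
    by (metis abs_mult abs_triangle_ineq4)
  also have "\<dots> \<le> B + \<bar>s\<bar> * B"
    using 1 by (intro add_mono mult_left_mono) auto
  finally have "1 + \<bar>fst z - s * snd z\<bar> \<le> (1 + B) * (1 + \<bar>s\<bar>)"
    using 1 by (simp add: algebra_simps)
  then have "(1 + \<bar>fst z - s * snd z\<bar>) powr \<alpha> \<le> (1 + B) powr \<alpha> * (1 + \<bar>s\<bar>) powr \<alpha>"
    using 1 assms(1) by (intro powr_le_mult_powr) auto
  with M assms(2)[of "fst z - s * snd z"] show ?thesis
    by (smt (verit) mult.assoc mult_left_mono)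
qed

text \<open>Dominated convergence along sequences, which are bounded when convergent. Continuity
  across the line \<open>y = 0\<close> is what gives the boundary values.\<close>

lemma continuous_on_poisson_ext:
  fixes g :: "real \<Rightarrow> real"
  assumes "0 < \<alpha>" "\<alpha> < 1" "continuous_on UNIV g" "\<And>t. \<bar>g t\<bar> \<le> M * (1 + \<bar>t\<bar>) powr \<alpha>"
  shows "continuous_on UNIV (poisson_ext g)"
proof -
  have [measurable]: "g \<in> borel_measurable borel"
    using assms(3) by (rule borel_measurable_continuous_onI)
  have "(\<lambda>n. poisson_ext g (Z n)) \<longlonglongrightarrow> poisson_ext g z" if Z: "Z \<longlonglongrightarrow> z" for Z z
  proof -
    obtain B where B: "\<And>n. norm (Z n) \<le> B"
      using convergent_imp_Bseq[OF convergentI[OF Z]] by (auto simp: Bseq_def)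
    have "(\<lambda>n. \<integral>s. g (fst (Z n) - s * snd (Z n)) \<partial>cauchy_measure)
            \<longlonglongrightarrow> (\<integral>s. g (fst z - s * snd z) \<partial>cauchy_measure)"
    proof (rule integral_dominated_convergence)
      show "integrable cauchy_measure (\<lambda>s. M * (1 + B) powr \<alpha> * (1 + \<bar>s\<bar>) powr \<alpha>)"
        using assms by (intro integrable_mult_right integrable_cauchy_powr) auto
      have "(\<lambda>n. g (fst (Z n) - s * snd (Z n))) \<longlonglongrightarrow> g (fst z - s * snd z)" for s
        by (rule continuous_on_tendsto_compose[OF assms(3)]) (auto intro!: tendsto_intros Z)
      then show "AE s in cauchy_measure. (\<lambda>n. g (fst (Z n) - s * snd (Z n))) \<longlonglongrightarrow> g (fst z - s * snd z)"
        by simp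
      show "AE s in cauchy_measure. norm (g (fst (Z n) - s * snd (Z n))) \<le> M * (1 + B) powr \<alpha> * (1 + \<bar>s\<bar>) powr \<alpha>" for n
        using abs_le_growth_shift[OF assms(1,4) B] by simp
    qed measurable
    then show ?thesis
      by (simp add: poisson_ext_def case_prod_beta)
  qed
  then show ?thesis
    by (auto simp: continuous_on_sequentially comp_def)
qed

text \<open>Encodes the identity
  \<open>w * (x - s * y) + b = (w, - (s * w)) \<bullet> (x, y) + b\<close>: averaging shifted ridge
  functions over \<open>s\<close> is again averaging ridge functions.\<close>

definition poisson_map :: "(real \<times> real \<times> real) \<times> real \<Rightarrow> real \<times> (real \<times> real) \<times> real" where
  "poisson_map = (\<lambda>((a, w, b), s). (a, (w, - (s * w)), b))"

definition poisson_param :: "(real \<times> real \<times> real) measure \<Rightarrow> (real \<times> (real \<times> real) \<times> real) measure" where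
  "poisson_param \<pi> = distr (\<pi> \<Otimes>\<^sub>M cauchy_measure) borel poisson_map"

lemma measurable_poisson_map:
  assumes "param_prob \<pi>"
  shows "poisson_map \<in> borel_measurable (\<pi> \<Otimes>\<^sub>M cauchy_measure)"
proof -
  have "sets (\<pi> \<Otimes>\<^sub>M cauchy_measure) = sets borel"
    using assms sets_pair_measure_cong[of \<pi> borel cauchy_measure borel]
    by (simp add: param_prob_def flip: borel_prod)
  moreover have "poisson_map \<in> borel_measurable borel"
    unfolding poisson_map_def case_prod_beta
    by (intro borel_measurable_continuous_onI continuous_intros)
  ultimately show ?thesis
    using measurable_cong_sets by blast
qed

lemma param_prob_poisson_param:
  assumes "param_prob \<pi>"
  shows "param_prob (poisson_param \<pi>)"
proof -
  interpret \<pi>: prob_space \<pi>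
    using assms by (simp add: param_prob_def)
  interpret c: prob_space cauchy_measure
    by (rule prob_space_cauchy_measure)
  interpret pair_prob_space \<pi> cauchy_measure ..
  have "prob_space (poisson_param \<pi>)"
    unfolding poisson_param_def by (rule prob_space_distr[OF measurable_poisson_map[OF assms]])
  then show ?thesis
    by (simp add: param_prob_def poisson_param_def)
qed

text \<open>The new weight has norm at most \<open>\<bar>w\<bar> * (1 + \<bar>s\<bar>)\<close>, so
  the moment is bounded by the old one times the Cauchy moment of order \<alpha>, which is
  finite.\<close>

lemma has_moment_poisson_param:
  assumes "0 < \<alpha>" "\<alpha> < 1" "param_prob \<pi>" "has_moment \<alpha> \<pi>"
  shows "has_moment \<alpha> (poisson_param \<pi>)"
proof -
  interpret \<pi>: prob_space \<pi>
    using assms by (simp add: param_prob_def)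
  interpret c: prob_space cauchy_measure
    by (rule prob_space_cauchy_measure)
  interpret pair_sigma_finite \<pi> cauchy_measure ..
  let ?m = "\<lambda>(a, w, b). \<bar>a\<bar> * (norm w + \<bar>b\<bar>) powr \<alpha> :: real"
  note [measurable] = measurable_poisson_map[OF assms(3)]
    measurable_param_prob[OF assms(3) measurable_moment_integrand[OF assms(1), where 'a = real]]
    measurable_moment_integrand[OF assms(1), where 'a = "real \<times> real"]
  have "integrable (\<pi> \<Otimes>\<^sub>M cauchy_measure) (\<lambda>(p, s). ?m p * (1 + \<bar>s\<bar>) powr \<alpha>)"
  proof (rule Fubini_integrable)
    have "integrable \<pi> (\<lambda>p. ?m p * (\<integral>s. (1 + \<bar>s\<bar>) powr \<alpha> \<partial>cauchy_measure))"
      using assms(4) by (simp add: has_moment_def)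
    then show "integrable \<pi> (\<lambda>p. \<integral>s. norm (case (p, s) of (p, s) \<Rightarrow> ?m p * (1 + \<bar>s\<bar>) powr \<alpha>) \<partial>cauchy_measure)"
      by (simp add: case_prod_beta abs_mult)
    show "AE p in \<pi>. integrable cauchy_measure (\<lambda>s. case (p, s) of (p, s) \<Rightarrow> ?m p * (1 + \<bar>s\<bar>) powr \<alpha>)"
      using integrable_cauchy_powr[of \<alpha>] assms by simp
  qed measurable
  then have "integrable (\<pi> \<Otimes>\<^sub>M cauchy_measure) (\<lambda>q. ?m (poisson_map q))"
  proof (rule Bochner_Integration.integrable_bound)
    have "norm (?m (poisson_map ((a, w, b), s))) \<le> norm (?m (a, w, b) * (1 + \<bar>s\<bar>) powr \<alpha>)" for a w b s
    proof -
      have "norm (w, - (s * w)) \<le> \<bar>w\<bar> + \<bar>s\<bar> * \<bar>w\<bar>"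
        using norm_Pair_le[of w "- (s * w)"] by (simp add: abs_mult)
      then have "norm (w, - (s * w)) + \<bar>b\<bar> \<le> (\<bar>w\<bar> + \<bar>b\<bar>) * (1 + \<bar>s\<bar>)"
        using mult_nonneg_nonneg[of "\<bar>b\<bar>" "\<bar>s\<bar>"] by (simp add: algebra_simps del: mult_nonneg_nonneg)
      then have "(norm (w, - (s * w)) + \<bar>b\<bar>) powr \<alpha> \<le> (\<bar>w\<bar> + \<bar>b\<bar>) powr \<alpha> * (1 + \<bar>s\<bar>) powr \<alpha>"
        using assms(1) by (intro powr_le_mult_powr) auto
      then show ?thesis
        by (simp add: poisson_map_def abs_mult mult.assoc mult_left_mono)
    qed
    then show "AE q in \<pi> \<Otimes>\<^sub>M cauchy_measure. norm (?m (poisson_map q)) \<le> norm (case q of (p, s) \<Rightarrow> ?m p * (1 + \<bar>s\<bar>) powr \<alpha>)"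
      by (intro AE_I2) (auto split: prod.split)
  qed measurable
  then show ?thesis
    unfolding has_moment_def poisson_param_def
    by (subst integrable_distr_eq) (auto simp: case_prod_beta)
qed

text \<open>By Fubini the parameters are integrated first with \<open>s\<close> fixed, which
  produces the one-dimensional network at \<open>x - s * y\<close>.\<close>

lemma net_fun_poisson_param:
  assumes "0 < \<alpha>" "\<alpha> < 1" "param_prob \<pi>" "has_moment \<alpha> \<pi>"
  shows "net_fun \<alpha> (poisson_param \<pi>) z = poisson_ext (net_fun \<alpha> \<pi>) z"
proof -
  interpret \<pi>: prob_space \<pi>
    using assms by (simp add: param_prob_def)
  interpret c: prob_space cauchy_measure
    by (rule prob_space_cauchy_measure)
  interpret pair_sigma_finite \<pi> cauchy_measure ..
  let ?h = "\<lambda>(a, w, b). a * relu_pow \<alpha> (w \<bullet> z + b)"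
  note [measurable] = measurable_poisson_map[OF assms(3)]
    measurable_net_integrand[OF assms(1), where 'a = "real \<times> real" and x = z]
  have int: "integrable (\<pi> \<Otimes>\<^sub>M cauchy_measure) (\<lambda>q. ?h (poisson_map q))"
  proof (rule iffD1[OF integrable_distr_eq[OF measurable_poisson_map[OF assms(3)] measurable_net_integrand[OF assms(1)]]])
    show "integrable (distr (\<pi> \<Otimes>\<^sub>M cauchy_measure) borel poisson_map) ?h"
      unfolding poisson_param_def[symmetric]
      by (intro integrable_net_integrand param_prob_poisson_param has_moment_poisson_param assms)
  qed
  have "net_fun \<alpha> (poisson_param \<pi>) z = (\<integral>q. ?h (poisson_map q) \<partial>(\<pi> \<Otimes>\<^sub>M cauchy_measure))"
    unfolding net_fun_def poisson_param_def by (subst integral_distr) auto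
  also have "\<dots> = (\<integral>s. (\<integral>p. ?h (poisson_map (p, s)) \<partial>\<pi>) \<partial>cauchy_measure)"
    using int by (subst integral_snd) (auto simp: case_prod_unfold)
  also have "\<dots> = poisson_ext (net_fun \<alpha> \<pi>) z"
    by (cases z) (simp add: poisson_ext_def net_fun_def poisson_map_def case_prod_unfold algebra_simps)
  finally show ?thesis .
qed

subsection \<open>Harmonicity of the Poisson integral\<close>

text \<open>
  The summand \<open>t / (1 + t\<^sup>2)\<close> makes the integral converge for sublinearly growing \<open>g\<close>; being real,
  it does not affect the imaginary part.
\<close>

definition cauchy_transform :: "(real \<Rightarrow> real) \<Rightarrow> complex \<Rightarrow> complex" where
  "cauchy_transform g z =
     (\<integral>t. of_real (g t) * (1 / (of_real t - z) - of_real (t / (1 + t\<^sup>2))) \<partial>lborel)"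

text \<open>The imaginary part keeps the distance above \<delta>, which handles bounded
  \<open>t\<close>; the triangle inequality handles large \<open>t\<close>. The constant depends on
  \<delta> and \<open>B\<close> only.\<close>

lemma one_plus_abs_le_dist:
  assumes "0 < \<delta>" "\<delta> \<le> Im z" "norm z \<le> B"
  shows "1 + \<bar>t\<bar> \<le> (1 + (1 + B) / \<delta>) * norm (of_real t - z)"
proof -
  have B: "0 \<le> B"
    using assms(3) norm_ge_zero[of z] by linarith
  have "\<delta> \<le> norm (of_real t - z)"
    using abs_Im_le_cmod[of "of_real t - z"] assms(1,2) by simp
  then have "(1 + B) / \<delta> * \<delta> \<le> (1 + B) / \<delta> * norm (of_real t - z)"
    using assms(1) B by (intro mult_left_mono) auto
  then have "1 + B \<le> (1 + B) / \<delta> * norm (of_real t - z)"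
    using assms(1) by simp
  moreover have "\<bar>t\<bar> \<le> norm (of_real t - z) + norm z"
    using norm_triangle_ineq[of "of_real t - z" z] by simp
  ultimately show ?thesis
    unfolding distrib_right using assms(3) by linarith
qed

lemma one_plus_square_le: "1 + t\<^sup>2 \<le> (1 + \<bar>t\<bar>)\<^sup>2" for t :: real
  by (simp add: power2_eq_square algebra_simps)

text \<open>Over the common denominator the numerator collapses to \<open>1 + t * z\<close>, so the
  kernel decays quadratically although each summand decays only linearly.\<close>

lemma cauchy_kernel_bound:
  assumes "0 < Im z"
  obtains C where "\<And>t. norm (1 / (of_real t - z) - of_real (t / (1 + t\<^sup>2))) \<le> C / (1 + t\<^sup>2)"
proof
  fix t :: real
  let ?C = "1 + (1 + norm z) / Im z"
  have C: "1 + \<bar>t\<bar> \<le> ?C * norm (of_real t - z)"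
    by (rule one_plus_abs_le_dist) (use assms in auto)
  have nz: "of_real t - z \<noteq> 0" "(1 + of_real t ^ 2 :: complex) \<noteq> 0" "0 < 1 + t\<^sup>2"
  proof -
    show "of_real t - z \<noteq> 0"
      using assms by (auto simp: complex_eq_iff)
    show *: "0 < 1 + t\<^sup>2"
      by (simp add: add_pos_nonneg)
    then have "(of_real (1 + t\<^sup>2) :: complex) \<noteq> 0"
      unfolding of_real_eq_0_iff by simp
    then show "(1 + of_real t ^ 2 :: complex) \<noteq> 0"
      by simp
  qed
  have "1 / (of_real t - z) - of_real (t / (1 + t\<^sup>2)) = (1 + of_real t * z) / ((of_real t - z) * of_real (1 + t\<^sup>2))"
    using nz by (simp add: divide_simps) (simp add: algebra_simps power2_eq_square)
  moreover have "norm (1 + of_real t * z) \<le> (1 + norm z) * (?C * norm (of_real t - z))"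
  proof -
    have "norm (1 + of_real t * z) \<le> 1 + \<bar>t\<bar> * norm z"
      using norm_triangle_ineq[of 1 "of_real t * z"] by (simp add: norm_mult)
    also have "\<dots> \<le> (1 + norm z) * (1 + \<bar>t\<bar>)"
      by (simp add: algebra_simps)
    also have "\<dots> \<le> (1 + norm z) * (?C * norm (of_real t - z))"
      using C by (intro mult_left_mono) auto
    finally show ?thesis .
  qed
  moreover have "norm (of_real (1 + t\<^sup>2) :: complex) = 1 + t\<^sup>2"
    unfolding norm_of_real using nz(3) by simp
  ultimately show "norm (1 / (of_real t - z) - of_real (t / (1 + t\<^sup>2))) \<le> ((1 + norm z) * ?C) / (1 + t\<^sup>2)"
    using nz(1,3) by (simp only: norm_divide norm_mult) (simp add: divide_simps mult_ac)
qed

text \<open>This expression is the difference quotient of the kernel between \<open>z\<close> and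
  \<open>w\<close>; uniformity in \<open>w\<close> permits differentiation under the
  integral.\<close>

lemma cauchy_kernel_diff_quotient_bound:
  assumes "0 < \<delta>" "\<delta> \<le> Im z" "norm z \<le> B" "\<delta> \<le> Im w" "norm w \<le> B"
  shows "norm (1 / ((of_real t - w) * (of_real t - z))) \<le> (1 + (1 + B) / \<delta>)\<^sup>2 / (1 + t\<^sup>2)"
proof -
  let ?C = "1 + (1 + B) / \<delta>"
  have nz: "of_real t - z \<noteq> 0" "of_real t - w \<noteq> 0" "0 < 1 + t\<^sup>2"
    using assms by (auto simp: complex_eq_iff add_pos_nonneg)
  have "1 + t\<^sup>2 \<le> (1 + \<bar>t\<bar>) * (1 + \<bar>t\<bar>)"
    using one_plus_square_le by (simp add: power2_eq_square)
  also have "\<dots> \<le> (?C * norm (of_real t - w)) * (?C * norm (of_real t - z))"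
    by (intro mult_mono one_plus_abs_le_dist order_trans[OF _ one_plus_abs_le_dist[OF assms(1,4,5)]]) (use assms in auto)
  finally show ?thesis
    using nz by (simp add: norm_divide norm_mult divide_simps power2_eq_square mult_ac)
qed

section \<open>Cauchy transforms of functions of sublinear growth\<close>

context
  fixes \<alpha> M :: real and g :: "real \<Rightarrow> real"
  assumes \<alpha>: "0 < \<alpha>" "\<alpha> < 1"
    and g_meas [measurable]: "g \<in> borel_measurable borel"
    and g_growth: "\<And>t. \<bar>g t\<bar> \<le> M * (1 + \<bar>t\<bar>) powr \<alpha>"
begin

text \<open>Quadratic decay of a kernel turns the growth of \<open>g\<close> into the integrable
  Poisson majorant; this serves both integrability and passage to the limit.\<close>

lemma norm_mult_kernel_le:
  assumes "norm k \<le> C / (1 + t\<^sup>2)"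
  shows "norm (of_real (g t) * k :: complex) \<le> M * C * ((1 + \<bar>t\<bar>) powr \<alpha> / (1 + t\<^sup>2))"
proof -
  have "norm (of_real (g t) * k) \<le> (M * (1 + \<bar>t\<bar>) powr \<alpha>) * (C / (1 + t\<^sup>2))"
    unfolding norm_mult norm_of_real
    by (intro mult_mono g_growth assms order_trans[OF _ g_growth]) auto
  then show ?thesis
    by (simp add: mult_ac)
qed

lemma integrable_kernel:
  fixes k :: "real \<Rightarrow> complex"
  assumes [measurable]: "k \<in> borel_measurable borel" and "\<And>t. norm (k t) \<le> C / (1 + t\<^sup>2)"
  shows "integrable lborel (\<lambda>t. of_real (g t) * k t)"
proof (rule Bochner_Integration.integrable_bound)
  show "integrable lborel (\<lambda>t. M * C * ((1 + \<bar>t\<bar>) powr \<alpha> / (1 + t\<^sup>2)))"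
    using \<alpha> by (intro integrable_mult_right integrable_poisson_majorant) auto
  show "AE t in lborel. norm (of_real (g t) * k t) \<le> norm (M * C * ((1 + \<bar>t\<bar>) powr \<alpha> / (1 + t\<^sup>2)))"
    unfolding real_norm_def by (intro AE_I2 order_trans[OF norm_mult_kernel_le[OF assms(2)] abs_ge_self])
qed measurable

lemma integrable_cauchy_kernel:
  assumes "0 < Im z"
  shows "integrable lborel (\<lambda>t. of_real (g t) * (1 / (of_real t - z) - of_real (t / (1 + t\<^sup>2))))"
proof -
  obtain C where "\<And>t. norm (1 / (of_real t - z) - of_real (t / (1 + t\<^sup>2))) \<le> C / (1 + t\<^sup>2)"
    using cauchy_kernel_bound[OF assms] by blast
  then show ?thesis
    by (intro integrable_kernel) measurable
qed

text \<open>Differentiation under the integral sign, by dominated convergence along sequences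
  tending to \<open>z\<close>.\<close>

lemma holomorphic_cauchy_transform: "cauchy_transform g holomorphic_on {z. 0 < Im z}"
  unfolding holomorphic_on_open[OF open_halfspace_Im_gt]
proof (intro ballI exI)
  fix z :: complex
  assume "z \<in> {z. 0 < Im z}"
  then have z: "0 < Im z"
    by simp
  \<comment> \<open>With half the height as radius, the ball around \<open>z\<close> stays at height
    at least \<delta> and within norm \<open>B\<close>.\<close>
  define \<delta> where "\<delta> = Im z / 2"
  define B where "B = norm z + \<delta>"
  define C where "C = (1 + (1 + B) / \<delta>)\<^sup>2"
  have \<delta>: "0 < \<delta>" "\<delta> \<le> Im z" "norm z \<le> B"
    using z by (auto simp: \<delta>_def B_def)
  have ball: "\<delta> \<le> Im w" "norm w \<le> B" if "w \<in> ball z \<delta>" for w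
  proof -
    have "norm (z - w) < \<delta>"
      using that by (simp add: dist_norm)
    then show "\<delta> \<le> Im w" "norm w \<le> B"
      using abs_Im_le_cmod[of "z - w"] norm_triangle_ineq4[of z "z - w"] by (auto simp: \<delta>_def B_def)
  qed
  let ?D = "\<integral>t. of_real (g t) * (1 / ((of_real t - z) * (of_real t - z))) \<partial>lborel :: complex"
  \<comment> \<open>Working within the ball makes the uniform kernel bound available for every term
    of an approaching sequence.\<close>
  have "(cauchy_transform g has_field_derivative ?D) (at z within ball z \<delta>)"
    unfolding has_field_derivative_iff tendsto_at_iff_sequentially
  proof (intro allI impI)
    fix X :: "nat \<Rightarrow> complex"
    assume X: "\<forall>i. X i \<in> ball z \<delta> - {z}" "X \<longlonglongrightarrow> z"
    have bound: "norm (1 / ((of_real t - X n) * (of_real t - z))) \<le> C / (1 + t\<^sup>2)" for n t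
      unfolding C_def using \<delta> ball X(1) by (intro cauchy_kernel_diff_quotient_bound) auto
    \<comment> \<open>The real correction does not depend on \<open>z\<close> and cancels, leaving
      \<open>X n - z\<close> as a common factor.\<close>
    have quot: "(cauchy_transform g (X n) - cauchy_transform g z) / (X n - z) =
        (\<integral>t. of_real (g t) * (1 / ((of_real t - X n) * (of_real t - z))) \<partial>lborel)" for n
    proof -
      have Xn: "0 < Im (X n)" "X n - z \<noteq> 0"
        using X(1) ball[of "X n"] \<delta>(1) by auto
      have "cauchy_transform g (X n) - cauchy_transform g z =
          (\<integral>t. of_real (g t) * (1 / (of_real t - X n) - of_real (t / (1 + t\<^sup>2)))
             - of_real (g t) * (1 / (of_real t - z) - of_real (t / (1 + t\<^sup>2))) \<partial>lborel)"
        unfolding cauchy_transform_def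
        by (rule Bochner_Integration.integral_diff[symmetric]; rule integrable_cauchy_kernel; fact)
      also have "\<dots> = (\<integral>t. (X n - z) * (of_real (g t) * (1 / ((of_real t - X n) * (of_real t - z)))) \<partial>lborel)"
      proof (intro Bochner_Integration.integral_cong refl)
        fix t :: real
        have "of_real t - X n \<noteq> 0" "of_real t - z \<noteq> 0"
          using Xn(1) z by (auto simp: complex_eq_iff)
        then have "1 / (of_real t - X n) - 1 / (of_real t - z) = (X n - z) * (1 / ((of_real t - X n) * (of_real t - z)))"
          by (simp add: divide_simps)
        then have "of_real (g t) * (1 / (of_real t - X n) - 1 / (of_real t - z)) = of_real (g t) * ((X n - z) * (1 / ((of_real t - X n) * (of_real t - z))))"
          by simp
        then show "of_real (g t) * (1 / (of_real t - X n) - of_real (t / (1 + t\<^sup>2)))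
             - of_real (g t) * (1 / (of_real t - z) - of_real (t / (1 + t\<^sup>2)))
            = (X n - z) * (of_real (g t) * (1 / ((of_real t - X n) * (of_real t - z))))"
          by (simp only: right_diff_distrib mult.assoc mult.left_commute) (simp add: algebra_simps)
      qed
      also have "\<dots> = (X n - z) * (\<integral>t. of_real (g t) * (1 / ((of_real t - X n) * (of_real t - z))) \<partial>lborel)"
        by (rule integral_mult_right_zero)
      finally show ?thesis
        using Xn(2) by simp
    qed
    have "(\<lambda>n. \<integral>t. of_real (g t) * (1 / ((of_real t - X n) * (of_real t - z))) \<partial>lborel) \<longlonglongrightarrow> ?D"
    proof (rule integral_dominated_convergence)
      show "integrable lborel (\<lambda>t. M * C * ((1 + \<bar>t\<bar>) powr \<alpha> / (1 + t\<^sup>2)))"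
        using \<alpha> by (intro integrable_mult_right integrable_poisson_majorant) auto
      show "AE t in lborel. norm (of_real (g t) * (1 / ((of_real t - X n) * (of_real t - z)))) \<le> M * C * ((1 + \<bar>t\<bar>) powr \<alpha> / (1 + t\<^sup>2))" for n
        by (intro AE_I2 norm_mult_kernel_le bound)
      have "of_real t - z \<noteq> 0" for t
        using z by (auto simp: complex_eq_iff)
      then show "AE t in lborel. (\<lambda>n. of_real (g t) * (1 / ((of_real t - X n) * (of_real t - z)))) \<longlonglongrightarrow> of_real (g t) * (1 / ((of_real t - z) * (of_real t - z)))"
        by (intro AE_I2 tendsto_intros X(2)) auto
    qed measurable
    then show "((\<lambda>y. (cauchy_transform g y - cauchy_transform g z) / (y - z)) \<circ> X) \<longlonglongrightarrow> ?D"
      by (simp add: comp_def quot)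
  qed
  then show "(cauchy_transform g has_field_derivative ?D) (at z)"
    using \<delta>(1) by (simp add: at_within_open[of z "ball z \<delta>"])
qed

text \<open>The imaginary part of the Cauchy kernel is \<pi> times the Poisson kernel, and the real
  correction contributes nothing.\<close>

lemma poisson_ext_eq_Im:
  assumes "0 < y"
  shows "poisson_ext g (x, y) = Im (cauchy_transform g (Complex x y)) / pi"
proof -
  let ?z = "Complex x y"
  have Im_kernel: "Im (1 / (of_real t - ?z)) = y / ((x - t)\<^sup>2 + y\<^sup>2)" for t
    by (simp add: Im_divide power2_commute)
  have Im_mult: "Im (of_real a * (w - of_real b)) = a * Im w" for a b w
    by simp
  have "Im (cauchy_transform g ?z) = (\<integral>t. Im (of_real (g t) * (1 / (of_real t - ?z) - of_real (t / (1 + t\<^sup>2)))) \<partial>lborel)"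
    unfolding cauchy_transform_def using assms by (intro integral_Im[symmetric] integrable_cauchy_kernel) simp
  also have "\<dots> = (\<integral>t. g t * (y / ((x - t)\<^sup>2 + y\<^sup>2)) \<partial>lborel)"
    by (simp only: Im_mult Im_kernel)
  \<comment> \<open>Substitution \<open>t = x - y * s\<close>, with Jacobian
    \<open>y\<close>.\<close>
  also have "\<dots> = \<bar>- y\<bar> *\<^sub>R (\<integral>s. g (x + - y * s) * (y / ((x - (x + - y * s))\<^sup>2 + y\<^sup>2)) \<partial>lborel)"
    using assms by (intro lborel_integral_real_affine) simp
  also have "\<dots> = (\<integral>s. y * (g (x + - y * s) * (y / ((x - (x + - y * s))\<^sup>2 + y\<^sup>2))) \<partial>lborel)"
    using assms by (simp only: integral_mult_right_zero real_scaleR_def abs_minus_cancel abs_of_pos)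
  also have "\<dots> = (\<integral>s. g (x - s * y) / (1 + s\<^sup>2) \<partial>lborel)"
  proof (intro Bochner_Integration.integral_cong refl)
    fix s :: real
    have "(x - (x + - y * s))\<^sup>2 + y\<^sup>2 = (y * y) * (1 + s\<^sup>2)"
      by (simp add: power2_eq_square algebra_simps)
    then show "y * (g (x + - y * s) * (y / ((x - (x + - y * s))\<^sup>2 + y\<^sup>2))) = g (x - s * y) / (1 + s\<^sup>2)"
      using assms by (simp add: mult_ac)
  qed
  also have "\<dots> = pi * poisson_ext g (x, y)"
    by (simp add: poisson_ext_def integral_cauchy)
  finally show ?thesis
    by simp
qed

end

section \<open>Transfer of derivatives between functions that agree on an open set\<close>

lemma partial_deriv_cong:
  assumes "open S" "z \<in> S" "\<And>p. p \<in> S \<Longrightarrow> f p = g p"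
  shows "partial_deriv i f z = partial_deriv i g z"
proof -
  \<comment> \<open>\<open>frechet_derivative\<close> is a choice from this predicate, so equivalent
    predicates give equal values even where no derivative exists.\<close>
  have "(f has_derivative f') (at z) \<longleftrightarrow> (g has_derivative f') (at z)" for f'
    using has_derivative_transform_within_open[OF _ assms(1,2), of f f' UNIV g]
      has_derivative_transform_within_open[OF _ assms(1,2), of g f' UNIV f] assms(3) by auto
  then show ?thesis
    by (simp add: partial_deriv_def frechet_derivative_def)
qed

lemma C1_on_cong:
  assumes "open S" "\<And>p. p \<in> S \<Longrightarrow> f p = g p" "C1_on S g"
  shows "C1_on S f"
  unfolding C1_on_def
proof (intro conjI ballI)
  fix z assume "z \<in> S"
  then show "f differentiable (at z)"
    using assms unfolding C1_on_def differentiable_def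
    by (metis has_derivative_transform_within_open)
next
  fix i :: 'a assume "i \<in> Basis"
  then have "continuous_on S (partial_deriv i g)"
    using assms(3) by (simp add: C1_on_def)
  then show "continuous_on S (partial_deriv i f)"
    using partial_deriv_cong[OF assms(1) _ assms(2)] by (simp cong: continuous_on_cong)
qed

lemma C2_on_cong:
  assumes "open S" "\<And>p. p \<in> S \<Longrightarrow> f p = g p" "C2_on S g"
  shows "C2_on S f"
  unfolding C2_on_def
proof (intro conjI ballI)
  show "C1_on S f"
    using assms by (auto simp: C2_on_def intro: C1_on_cong)
next
  fix i :: 'a assume "i \<in> Basis"
  then have "C1_on S (partial_deriv i g)"
    using assms(3) by (simp add: C2_on_def)
  then show "C1_on S (partial_deriv i f)"
    by (rule C1_on_cong[OF assms(1) partial_deriv_cong[OF assms(1) _ assms(2)], rotated -1])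
qed

lemma laplacian_cong:
  assumes "open S" "z \<in> S" "\<And>p. p \<in> S \<Longrightarrow> f p = g p"
  shows "laplacian f z = laplacian g z"
  unfolding laplacian_def
  by (intro sum.cong refl partial_deriv_cong[OF assms(1,2)] partial_deriv_cong[OF assms(1) _ assms(3)])

section \<open>Imaginary parts of holomorphic functions as functions of two real variables\<close>

definition Im_fun :: "(complex \<Rightarrow> complex) \<Rightarrow> real \<times> real \<Rightarrow> real" where
  "Im_fun f p = Im (f (Complex (fst p) (snd p)))"

lemma open_upper_half_plane: "open upper_half_plane"
proof -
  have *: "upper_half_plane = snd -` {0<..}"
    by (auto simp: upper_half_plane_def)
  show ?thesis
    unfolding * by (intro open_vimage_snd open_greaterThan)
qed

lemma has_derivative_Im_fun:
  assumes "(f has_field_derivative f') (at (Complex (fst p) (snd p)))"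
  shows "(Im_fun f has_derivative (\<lambda>h. Im (f' * Complex (fst h) (snd h)))) (at p)"
proof -
  have C: "Complex (fst q) (snd q) = of_real (fst q) + \<i> * of_real (snd q)" for q
    by (simp add: complex_eq_iff)
  have "((\<lambda>q. Complex (fst q) (snd q)) has_derivative (\<lambda>q. Complex (fst q) (snd q))) (at p)"
    unfolding C by (auto intro!: derivative_eq_intros)
  from has_derivative_compose[OF this assms[unfolded has_field_derivative_def]]
  show ?thesis
    unfolding Im_fun_def by (rule has_derivative_Im)
qed

text \<open>The directions \<open>(1, 0)\<close> and \<open>(0, 1)\<close> correspond to 1 and
  \<open>\<i>\<close>. Partial derivatives thus stay in the class of imaginary parts of holomorphic
  functions, and second derivatives come from a second application.\<close>

lemma
  assumes "f holomorphic_on {z. 0 < Im z}" "p \<in> upper_half_plane"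
  shows differentiable_Im_fun: "Im_fun f differentiable (at p)"
    and partial_deriv_Im_fun_fst: "partial_deriv (1, 0) (Im_fun f) p = Im_fun (deriv f) p"
    and partial_deriv_Im_fun_snd: "partial_deriv (0, 1) (Im_fun f) p = Im_fun (\<lambda>z. \<i> * deriv f z) p"
proof -
  have "(f has_field_derivative deriv f (Complex (fst p) (snd p))) (at (Complex (fst p) (snd p)))"
    using assms by (intro holomorphic_derivI[OF assms(1) open_halfspace_Im_gt])
      (auto simp: upper_half_plane_def)
  note d = has_derivative_Im_fun[OF this]
  then show "Im_fun f differentiable (at p)"
    by (auto simp: differentiable_def)
  show "partial_deriv (1, 0) (Im_fun f) p = Im_fun (deriv f) p"
    "partial_deriv (0, 1) (Im_fun f) p = Im_fun (\<lambda>z. \<i> * deriv f z) p"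
    by (simp_all add: partial_deriv_def frechet_derivative_at[OF d, symmetric] Im_fun_def)
qed

lemma Basis_real_pair: "(Basis :: (real \<times> real) set) = {(1, 0), (0, 1)}"
  by (auto simp: Basis_prod_def)

lemma continuous_on_Im_fun:
  assumes "f holomorphic_on {z. 0 < Im z}"
  shows "continuous_on upper_half_plane (Im_fun f)"
  using differentiable_Im_fun[OF assms]
  by (auto intro!: continuous_at_imp_continuous_on differentiable_imp_continuous_within)

lemma C1_on_Im_fun:
  assumes f: "f holomorphic_on {z. 0 < Im z}"
  shows "C1_on upper_half_plane (Im_fun f)"
proof -
  have "deriv f holomorphic_on {z. 0 < Im z}"
    by (intro holomorphic_deriv f open_halfspace_Im_gt)
  then have "continuous_on upper_half_plane (Im_fun (deriv f))"
    "continuous_on upper_half_plane (Im_fun (\<lambda>z. \<i> * deriv f z))"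
    by (auto intro!: continuous_on_Im_fun holomorphic_intros)
  then show ?thesis
    by (auto simp: C1_on_def Basis_real_pair differentiable_Im_fun[OF f]
        partial_deriv_Im_fun_fst[OF f] partial_deriv_Im_fun_snd[OF f] cong: continuous_on_cong)
qed

lemma C2_on_Im_fun:
  assumes f: "f holomorphic_on {z. 0 < Im z}"
  shows "C2_on upper_half_plane (Im_fun f)"
proof -
  have "deriv f holomorphic_on {z. 0 < Im z}"
    by (intro holomorphic_deriv f open_halfspace_Im_gt)
  then have "C1_on upper_half_plane (Im_fun (deriv f))"
    "C1_on upper_half_plane (Im_fun (\<lambda>z. \<i> * deriv f z))"
    by (auto intro!: C1_on_Im_fun holomorphic_intros)
  then have "C1_on upper_half_plane (partial_deriv (1, 0) (Im_fun f))"
    "C1_on upper_half_plane (partial_deriv (0, 1) (Im_fun f))"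
    using C1_on_cong[OF open_upper_half_plane partial_deriv_Im_fun_fst[OF f]]
      C1_on_cong[OF open_upper_half_plane partial_deriv_Im_fun_snd[OF f]] by auto
  with C1_on_Im_fun[OF f] show ?thesis
    by (simp add: C2_on_def Basis_real_pair)
qed

text \<open>Differentiating twice in \<open>y\<close> contributes the factor
  \<open>\<i> * \<i> = - 1\<close>, which cancels the second derivative in \<open>x\<close>.\<close>

lemma laplacian_Im_fun:
  assumes f: "f holomorphic_on {z. 0 < Im z}" and p: "p \<in> upper_half_plane"
  shows "laplacian (Im_fun f) p = 0"
proof -
  have f': "deriv f holomorphic_on {z. 0 < Im z}" "(\<lambda>z. \<i> * deriv f z) holomorphic_on {z. 0 < Im z}"
    by (auto intro!: holomorphic_intros holomorphic_deriv f open_halfspace_Im_gt)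
  have z: "Complex (fst p) (snd p) \<in> {z. 0 < Im z}"
    using p by (auto simp: upper_half_plane_def)
  have "partial_deriv (1, 0) (partial_deriv (1, 0) (Im_fun f)) p = Im_fun (deriv (deriv f)) p"
    using partial_deriv_cong[OF open_upper_half_plane p partial_deriv_Im_fun_fst[OF f]]
      partial_deriv_Im_fun_fst[OF f'(1) p] by simp
  moreover have "partial_deriv (0, 1) (partial_deriv (0, 1) (Im_fun f)) p = Im_fun (\<lambda>z. \<i> * deriv (\<lambda>z. \<i> * deriv f z) z) p"
    using partial_deriv_cong[OF open_upper_half_plane p partial_deriv_Im_fun_snd[OF f]]
      partial_deriv_Im_fun_snd[OF f'(2) p] by simp
  moreover have "deriv (\<lambda>z. \<i> * deriv f z) (Complex (fst p) (snd p)) = \<i> * deriv (deriv f) (Complex (fst p) (snd p))"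
    by (intro deriv_cmult holomorphic_on_imp_differentiable_at[OF f'(1) open_halfspace_Im_gt z])
  ultimately show ?thesis
    by (simp add: laplacian_def Basis_real_pair Im_fun_def)
qed

text \<open>Agreement on the open half plane suffices, so the result applies to a restriction that
  is \<open>undefined\<close> elsewhere; \<open>poisson_ext g\<close> itself is the continuous
  extension.\<close>

lemma solves_dirichlet_poisson_ext:
  fixes g :: "real \<Rightarrow> real"
  assumes "0 < \<alpha>" "\<alpha> < 1" "continuous_on UNIV g" "\<And>t. \<bar>g t\<bar> \<le> M * (1 + \<bar>t\<bar>) powr \<alpha>"
    "\<And>z. z \<in> upper_half_plane \<Longrightarrow> u z = poisson_ext g z"
  shows "solves_dirichlet u g"
proof -
  have meas: "g \<in> borel_measurable borel"
    using assms(3) by (rule borel_measurable_continuous_onI)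
  let ?f = "\<lambda>z. cauchy_transform g z / of_real pi"
  have f: "?f holomorphic_on {z. 0 < Im z}"
    by (intro holomorphic_intros holomorphic_cauchy_transform[OF assms(1,2) meas assms(4)]) simp
  have eq: "u z = Im_fun ?f z" if "z \<in> upper_half_plane" for z
    using that assms(5)[OF that] poisson_ext_eq_Im[OF assms(1,2) meas assms(4)]
    by (auto simp: Im_fun_def upper_half_plane_def)
  have "has_boundary_values u g"
    unfolding has_boundary_values_def
    using continuous_on_subset[OF continuous_on_poisson_ext[OF assms(1-4)] subset_UNIV]
    by (intro exI[of _ "poisson_ext g"]) (simp add: assms(5) poisson_ext_boundary)
  then show ?thesis
    using C2_on_cong[OF open_upper_half_plane eq C2_on_Im_fun[OF f]]
      laplacian_cong[OF open_upper_half_plane _ eq] laplacian_Im_fun[OF f]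
    by (simp add: solves_dirichlet_def)
qed

subsection \<open>Comparison of sublinear solutions\<close>

text \<open>Reduces partial derivatives to one-variable calculus along a coordinate line.\<close>

lemma has_real_derivative_slice:
  fixes f :: "'a::euclidean_space \<Rightarrow> real"
  assumes "f differentiable (at (p + t *\<^sub>R i))"
  shows "((\<lambda>t. f (p + t *\<^sub>R i)) has_real_derivative partial_deriv i f (p + t *\<^sub>R i)) (at t)"
proof -
  let ?L = "frechet_derivative f (at (p + t *\<^sub>R i))"
  have L: "(f has_derivative ?L) (at (p + t *\<^sub>R i))"
    using assms by (simp add: frechet_derivative_works)
  have "((\<lambda>t. p + t *\<^sub>R i) has_derivative (\<lambda>h. h *\<^sub>R i)) (at t)"
    by (auto intro!: derivative_eq_intros)
  from has_derivative_compose[OF this L]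
  show ?thesis
    using linear_cmul[OF has_derivative_linear[OF L]]
    by (simp add: has_field_derivative_def partial_deriv_def mult_commute_abs)
qed

text \<open>Otherwise \<open>\<phi>'\<close>, which vanishes at 0, would be positive just to the
  right, and the mean value theorem would put a larger value of \<open>\<phi>\<close> there.\<close>

lemma second_deriv_nonpos_at_local_max:
  fixes \<phi> \<phi>' :: "real \<Rightarrow> real"
  assumes "0 < d" "\<And>t. \<bar>t\<bar> < d \<Longrightarrow> (\<phi> has_real_derivative \<phi>' t) (at t)"
    "(\<phi>' has_real_derivative c) (at 0)" "\<And>t. \<bar>t\<bar> < d \<Longrightarrow> \<phi> t \<le> \<phi> 0"
  shows "c \<le> 0"
proof (rule ccontr)
  assume "\<not> c \<le> 0"
  moreover have "\<phi>' 0 = 0"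
    using assms(1,2,4) by (intro DERIV_local_max[of \<phi> "\<phi>' 0" 0 d]) auto
  ultimately obtain e where e: "0 < e" "\<And>h. 0 < h \<Longrightarrow> h < e \<Longrightarrow> 0 < \<phi>' h"
    using DERIV_pos_inc_right[OF assms(3)] by auto
  define s where "s = min d e / 2"
  have s: "0 < s" "s < d" "s < e"
    using assms(1) e(1) by (auto simp: s_def)
  obtain t where "0 < t" "t < s" "\<phi> s - \<phi> 0 = (s - 0) * \<phi>' t"
    using MVT2[OF s(1), of \<phi> \<phi>'] assms(2) s by force
  with e(2)[of t] s assms(4)[of s] show False
    by (smt (verit) mult_pos_pos)
qed

text \<open>Here \<open>q\<close> is the slice of the comparison polynomial, whose derivatives are
  known explicitly; only \<open>u\<close> and \<open>v\<close> go through
  \<open>partial_deriv\<close>.\<close>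

lemma slice_second_deriv_nonpos:
  fixes u v :: "'a::euclidean_space \<Rightarrow> real" and q q' :: "real \<Rightarrow> real"
  assumes "open S" "p \<in> S" "i \<in> Basis" "C2_on S u" "C2_on S v"
    "\<And>t. (q has_real_derivative q' t) (at t)" "(q' has_real_derivative c) (at 0)" "0 < e"
    "\<And>t. \<bar>t\<bar> < e \<Longrightarrow> u (p + t *\<^sub>R i) - v (p + t *\<^sub>R i) - q t \<le> u p - v p - q 0"
  shows "partial_deriv i (partial_deriv i u) p - partial_deriv i (partial_deriv i v) p - c \<le> 0"
proof -
  obtain d where d: "0 < d" "ball p d \<subseteq> S"
    using assms(1,2) by (meson openE)
  have slice: "p + t *\<^sub>R i \<in> S" if "\<bar>t\<bar> < d" for t
    using that d(2) assms(3) by (auto simp: dist_norm subset_iff)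
  have diff: "w differentiable (at (p + t *\<^sub>R i))" "partial_deriv i w differentiable (at (p + t *\<^sub>R i))"
    if "\<bar>t\<bar> < d" "C2_on S w" for t w
    using slice[OF that(1)] that(2) assms(3) by (auto simp: C2_on_def C1_on_def)
  show ?thesis
  proof (rule second_deriv_nonpos_at_local_max[of "min d e" "\<lambda>t. u (p + t *\<^sub>R i) - v (p + t *\<^sub>R i) - q t"
        "\<lambda>t. partial_deriv i u (p + t *\<^sub>R i) - partial_deriv i v (p + t *\<^sub>R i) - q' t"])
    show "((\<lambda>t. u (p + t *\<^sub>R i) - v (p + t *\<^sub>R i) - q t) has_real_derivative
        partial_deriv i u (p + t *\<^sub>R i) - partial_deriv i v (p + t *\<^sub>R i) - q' t) (at t)" if "\<bar>t\<bar> < min d e" for t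
      using that by (intro DERIV_diff has_real_derivative_slice diff assms) auto
    show "((\<lambda>t. partial_deriv i u (p + t *\<^sub>R i) - partial_deriv i v (p + t *\<^sub>R i) - q' t) has_real_derivative
        partial_deriv i (partial_deriv i u) p - partial_deriv i (partial_deriv i v) p - c) (at 0)"
      using has_real_derivative_slice[OF diff(2)[of 0, OF _ assms(4)]]
        has_real_derivative_slice[OF diff(2)[of 0, OF _ assms(5)]] d(1)
      by (intro DERIV_diff assms(7)) auto
  qed (use assms(8,9) d(1) in auto)
qed

lemma closure_upper_half_plane: "closure upper_half_plane = {z. 0 \<le> snd z}"
proof -
  have *: "upper_half_plane = UNIV \<times> {0<..}"
    by (auto simp: upper_half_plane_def)
  show ?thesis
    unfolding * closure_Times closure_UNIV closure_greaterThan by auto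
qed

text \<open>
  On the rectangle \<open>[-R, R] \<times> [0, R]\<close> the difference of two solutions is dominated by \<open>K\<close> times the
  strictly superharmonic polynomial \<open>(x\<^sup>2 + 4 R y - 2 y\<^sup>2) / R\<^sup>2\<close>, which is at least \<open>1\<close> on the three
  sides inside the half plane.
\<close>

lemma solves_dirichlet_diff_le:
  assumes "solves_dirichlet u g" "solves_dirichlet v g" "0 < R" "0 < K"
    "\<And>x y. \<bar>x\<bar> \<le> R \<Longrightarrow> 0 < y \<Longrightarrow> y \<le> R \<Longrightarrow> u (x, y) - v (x, y) \<le> K"
    "\<bar>x\<bar> \<le> R" "0 < y" "y \<le> R"
  shows "u (x, y) - v (x, y) \<le> K * ((x\<^sup>2 + 4 * R * y - 2 * y\<^sup>2) / R\<^sup>2)"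
proof -
  from assms(1) obtain U where U: "continuous_on (closure upper_half_plane) U"
    "\<And>z. z \<in> upper_half_plane \<Longrightarrow> U z = u z" "\<And>x. U (x, 0) = g x"
    by (auto simp: solves_dirichlet_def has_boundary_values_def)
  from assms(2) obtain V where V: "continuous_on (closure upper_half_plane) V"
    "\<And>z. z \<in> upper_half_plane \<Longrightarrow> V z = v z" "\<And>x. V (x, 0) = g x"
    by (auto simp: solves_dirichlet_def has_boundary_values_def)
  define Q :: "real \<times> real \<Rightarrow> real" where
    "Q = (\<lambda>(x, y). K * ((x\<^sup>2 + 4 * R * y - 2 * y\<^sup>2) / R\<^sup>2))"
  let ?W = "\<lambda>z. U z - V z - Q z"
  let ?rect = "{-R..R} \<times> {0..R}"
  have "?rect \<subseteq> closure upper_half_plane"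
    by (auto simp: closure_upper_half_plane)
  then have "continuous_on ?rect ?W"
    unfolding Q_def case_prod_beta using assms(3)
    by (intro continuous_intros continuous_on_subset[OF U(1)] continuous_on_subset[OF V(1)]) auto
  moreover have "compact ?rect" "?rect \<noteq> {}"
    using assms(3) by (auto intro: compact_Times)
  ultimately obtain p where p: "p \<in> ?rect" "\<And>z. z \<in> ?rect \<Longrightarrow> ?W z \<le> ?W p"
    using continuous_attains_sup[of ?rect ?W] by auto
  obtain a b where ab: "p = (a, b)"
    by fastforce
  have "?W p \<le> 0"
  proof (cases "\<bar>a\<bar> < R \<and> 0 < b \<and> b < R")
    case True
    \<comment> \<open>The distance to the nearest side: shorter coordinate steps stay in the
      rectangle and off the real axis.\<close>
    define e where "e = min (R - \<bar>a\<bar>) (min b (R - b))"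
    have e: "0 < e"
      using True by (auto simp: e_def)
    have p_in: "p \<in> upper_half_plane"
      using True ab by (simp add: upper_half_plane_def)
    have near: "u (p + t *\<^sub>R i) - v (p + t *\<^sub>R i) - Q (p + t *\<^sub>R i) \<le> u p - v p - Q p"
      if "\<bar>t\<bar> < e" "i \<in> {(1, 0), (0, 1)}" for t i
    proof -
      have "p + t *\<^sub>R i \<in> ?rect" "p + t *\<^sub>R i \<in> upper_half_plane"
        using that by (auto simp: ab e_def upper_half_plane_def)
      then show ?thesis
        using p(2) U(2) V(2) p_in by metis
    qed
    have C2: "C2_on upper_half_plane u" "C2_on upper_half_plane v"
      using assms(1,2) by (auto simp: solves_dirichlet_def)
    \<comment> \<open>The two second-derivative inequalities add up to
      \<open>2 * K / R\<^sup>2 \<le> 0\<close>, because both Laplacians vanish. An interior maximum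
      is therefore impossible and this case closes by contradiction.\<close>
    have "partial_deriv (1, 0) (partial_deriv (1, 0) u) p - partial_deriv (1, 0) (partial_deriv (1, 0) v) p - 2 * K / R\<^sup>2 \<le> 0"
    proof (rule slice_second_deriv_nonpos[OF open_upper_half_plane p_in _ C2 _ _ e])
      show "((\<lambda>t. Q (p + t *\<^sub>R (1, 0))) has_real_derivative K * (2 * (a + t) / R\<^sup>2)) (at t)" for t
        unfolding ab Q_def using assms(3)
        by (auto intro!: derivative_eq_intros simp: field_simps power2_eq_square)
      show "((\<lambda>t. K * (2 * (a + t) / R\<^sup>2)) has_real_derivative 2 * K / R\<^sup>2) (at 0)"
        using assms(3) by (auto intro!: derivative_eq_intros simp: field_simps power2_eq_square)
    qed (use near[of _ "(1, 0)"] in \<open>auto simp: Basis_real_pair simp flip: zero_prod_def\<close>)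
    moreover have "partial_deriv (0, 1) (partial_deriv (0, 1) u) p - partial_deriv (0, 1) (partial_deriv (0, 1) v) p - - 4 * K / R\<^sup>2 \<le> 0"
    proof (rule slice_second_deriv_nonpos[OF open_upper_half_plane p_in _ C2 _ _ e])
      show "((\<lambda>t. Q (p + t *\<^sub>R (0, 1))) has_real_derivative K * ((4 * R - 4 * (b + t)) / R\<^sup>2)) (at t)" for t
        unfolding ab Q_def using assms(3)
        by (auto intro!: derivative_eq_intros simp: field_simps power2_eq_square)
      show "((\<lambda>t. K * ((4 * R - 4 * (b + t)) / R\<^sup>2)) has_real_derivative - 4 * K / R\<^sup>2) (at 0)"
        using assms(3) by (auto intro!: derivative_eq_intros simp: field_simps power2_eq_square)
    qed (use near[of _ "(0, 1)"] in \<open>auto simp: Basis_real_pair simp flip: zero_prod_def\<close>)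
    moreover have "laplacian u p = 0" "laplacian v p = 0"
      using assms(1,2) p_in by (auto simp: solves_dirichlet_def)
    moreover have "0 < K / R\<^sup>2"
      using assms(3,4) by simp
    ultimately show ?thesis
      by (simp add: laplacian_def Basis_real_pair)
  next
    case False
    have bounds: "\<bar>a\<bar> \<le> R" "0 \<le> b" "b \<le> R"
      using p(1) ab by auto
    show ?thesis
    proof (cases "b = 0")
      \<comment> \<open>On the real axis the boundary values cancel, and \<open>Q\<close> reduces to
        the nonnegative \<open>K * (a\<^sup>2 / R\<^sup>2)\<close>.\<close>
      case True
      then show ?thesis
        using assms(3,4) by (simp add: ab U(3) V(3) Q_def)
    next
      case b: False
      then have "U p - V p \<le> K"
        using assms(5)[of a b] bounds U(2)[of p] V(2)[of p] ab by (simp add: upper_half_plane_def)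
      \<comment> \<open>On the lateral sides the square of \<open>a\<close> is enough, since
        \<open>4 * R * b - 2 * b\<^sup>2 \<ge> 0\<close>; on the top the terms in \<open>b\<close>
        already give \<open>2 * R\<^sup>2\<close>.\<close>
      moreover have "R\<^sup>2 \<le> a\<^sup>2 + 4 * R * b - 2 * b\<^sup>2"
      proof -
        have *: "b * b \<le> R * b" "0 \<le> R * b"
          using bounds assms(3) by (auto intro: mult_right_mono)
        consider "\<bar>a\<bar> = R" | "b = R"
          using False b bounds by linarith
        then show ?thesis
        proof cases
          case 1
          then have "a\<^sup>2 = R\<^sup>2"
            by (metis power2_abs)
          with * show ?thesis
            by (simp add: power2_eq_square)
        qed (use * in \<open>simp add: power2_eq_square\<close>)
      qed
      then have "K * 1 \<le> Q p"
        unfolding Q_def ab using assms(3,4) by (simp add: le_divide_eq)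
      ultimately show ?thesis
        by simp
    qed
  qed
  moreover have "?W (x, y) \<le> ?W p"
    using assms(6-8) by (intro p(2)) auto
  moreover have "U (x, y) = u (x, y)" "V (x, y) = v (x, y)"
    using U(2) V(2) assms(7) by (auto simp: upper_half_plane_def)
  ultimately show ?thesis
    by (simp add: Q_def)
qed

text \<open>On the rectangle of size \<open>R\<close> the difference is of order at most
  \<open>R powr \<alpha>\<close>, while the polynomial at a fixed point is of order
  \<open>1 / R\<close>; the product tends to 0 because \<alpha> < 1.\<close>

lemma solves_dirichlet_le:
  assumes "solves_dirichlet u g" "solves_dirichlet v g" "0 < \<alpha>" "\<alpha> < 1"
    "\<And>z. z \<in> upper_half_plane \<Longrightarrow> \<bar>u z\<bar> \<le> M * (1 + norm z) powr \<alpha>"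
    "\<And>z. z \<in> upper_half_plane \<Longrightarrow> \<bar>v z\<bar> \<le> N * (1 + norm z) powr \<alpha>"
    "z \<in> upper_half_plane"
  shows "u z \<le> v z"
proof -
  obtain x y where z: "z = (x, y)" "0 < y"
    using assms(7) by (auto simp: upper_half_plane_def)
  \<comment> \<open>The absolute values avoid sign conditions on \<open>M\<close> and
    \<open>N\<close>; the summand 1 secures the strict positivity needed of the comparison
    constant.\<close>
  define L where "L = \<bar>M\<bar> + \<bar>N\<bar> + 1"
  have L: "0 < L"
    by (simp add: L_def)
  have "u z - v z \<le> L * (1 + 2 * R) powr \<alpha> * ((x\<^sup>2 + 4 * R * y - 2 * y\<^sup>2) / R\<^sup>2)"
    if R: "\<bar>x\<bar> \<le> R" "y \<le> R" for R
    unfolding z(1)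
  proof (rule solves_dirichlet_diff_le[OF assms(1,2) _ _ _ R(1) z(2) R(2)])
    show "0 < R"
      using R z(2) by simp
    then show "0 < L * (1 + 2 * R) powr \<alpha>"
      using L by simp
    fix x' y' :: real
    assume x'y': "\<bar>x'\<bar> \<le> R" "0 < y'" "y' \<le> R"
    let ?n = "(1 + norm (x', y')) powr \<alpha>"
    have "norm (x', y') \<le> 2 * R"
      using norm_Pair_le[of x' y'] x'y' by simp
    then have n: "?n \<le> (1 + 2 * R) powr \<alpha>"
      using assms(3) by (intro powr_mono2) auto
    have "u (x', y') - v (x', y') \<le> M * ?n + N * ?n"
      using assms(5,6)[of "(x', y')"] x'y'(2) by (simp add: upper_half_plane_def abs_le_iff)
    also have "\<dots> \<le> L * ?n"
      unfolding distrib_right[symmetric] by (intro mult_right_mono) (auto simp: L_def)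
    also have "\<dots> \<le> L * (1 + 2 * R) powr \<alpha>"
      using n L by (intro mult_left_mono) auto
    finally show "u (x', y') - v (x', y') \<le> L * (1 + 2 * R) powr \<alpha>" .
  qed
  then have "\<forall>\<^sub>F R in at_top. u z - v z \<le> L * (1 + 2 * R) powr \<alpha> * ((x\<^sup>2 + 4 * R * y - 2 * y\<^sup>2) / R\<^sup>2)"
    by (intro eventually_mono[OF eventually_ge_at_top[of "max \<bar>x\<bar> y"]]) auto
  moreover have "((\<lambda>R. L * (1 + 2 * R) powr \<alpha> * ((x\<^sup>2 + 4 * R * y - 2 * y\<^sup>2) / R\<^sup>2)) \<longlongrightarrow> 0) at_top"
    using assms(3,4) z(2) L by real_asymp
  ultimately have "u z - v z \<le> 0"
    by (intro tendsto_lowerbound) auto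
  then show ?thesis
    by simp
qed

theorem corollary3p7:
  fixes \<alpha> :: real and g :: "real \<Rightarrow> real"
  assumes "0 < \<alpha>" and "\<alpha> < 1"
    and "g \<in> barron_space \<alpha> UNIV"
  shows "\<exists>!u. u \<in> barron_space \<alpha> upper_half_plane \<and> solves_dirichlet u g"
proof (rule ex_ex1I)
  obtain \<pi> where \<pi>: "param_prob \<pi>" "has_moment \<alpha> \<pi>" "\<And>x. g x = net_fun \<alpha> \<pi> x"
    using barron_spaceE[OF assms(1,3)] by auto
  obtain M where M: "\<And>x. \<bar>g x\<bar> \<le> M * (1 + norm x) powr \<alpha>"
    using barron_space_growth[OF assms(1,3)] by auto
  have g: "continuous_on UNIV g"
    using assms(3) by (simp add: barron_space_def)
  have M': "\<bar>g t\<bar> \<le> M * (1 + \<bar>t\<bar>) powr \<alpha>" for t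
    using M[of t] by simp
  \<comment> \<open>Restriction makes the Poisson integral extensional, as membership in the space
    demands.\<close>
  let ?u = "restrict (poisson_ext g) upper_half_plane"
  have "?u \<in> barron_space \<alpha> upper_half_plane"
  proof (rule barron_spaceI[OF assms(1)])
    show "continuous_on upper_half_plane ?u"
      using continuous_on_subset[OF continuous_on_poisson_ext[OF assms(1,2) g M'] subset_UNIV]
      by (simp cong: continuous_on_cong)
    have "g = net_fun \<alpha> \<pi>"
      using \<pi>(3) by auto
    then show "?u z = net_fun \<alpha> (poisson_param \<pi>) z" if "z \<in> upper_half_plane" for z
      using that net_fun_poisson_param[OF assms(1,2) \<pi>(1,2)] by simp
  qed (auto intro: param_prob_poisson_param has_moment_poisson_param assms \<pi>)
  moreover have "solves_dirichlet ?u g"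
    by (rule solves_dirichlet_poisson_ext[OF assms(1,2) g M']) simp
  ultimately show "\<exists>u. u \<in> barron_space \<alpha> upper_half_plane \<and> solves_dirichlet u g"
    by blast
next
  fix u v
  assume u: "u \<in> barron_space \<alpha> upper_half_plane \<and> solves_dirichlet u g"
    and v: "v \<in> barron_space \<alpha> upper_half_plane \<and> solves_dirichlet v g"
  obtain M where M: "\<And>z. z \<in> upper_half_plane \<Longrightarrow> \<bar>u z\<bar> \<le> M * (1 + norm z) powr \<alpha>"
    using barron_space_growth[OF assms(1) conjunct1[OF u]] by auto
  obtain N where N: "\<And>z. z \<in> upper_half_plane \<Longrightarrow> \<bar>v z\<bar> \<le> N * (1 + norm z) powr \<alpha>"
    using barron_space_growth[OF assms(1) conjunct1[OF v]] by auto
  show "u = v"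
  proof (rule extensionalityI)
    show "u \<in> extensional upper_half_plane" "v \<in> extensional upper_half_plane"
      using u v by (auto simp: barron_space_def)
    \<comment> \<open>The comparison is one-sided, so it is applied twice with the roles
      exchanged.\<close>
    show "u z = v z" if "z \<in> upper_half_plane" for z
      using solves_dirichlet_le[OF conjunct2[OF u] conjunct2[OF v] assms(1,2) M N that]
        solves_dirichlet_le[OF conjunct2[OF v] conjunct2[OF u] assms(1,2) N M that] by simp
  qed
qed

end
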